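(* Let $\mathscr{S}$ be a collection of spectral functions. The risk measure $\rho_{\mathscr{S}}$ is finite valued on $L_{\mathscr{S}}$, and it is moreover continuous with respect to the norm $\|\cdot\|_{\mathscr{S}}$ with Lipschitz constant $1$.
   Context: Let $(\Omega,\mathcal{F},P)$ be a probability space; real-valued random variables are identified when almost surely equal and $L^1=L^1(\Omega,\mathcal{F},P)$. A spectral function is a nondecreasing function $\sigma:[0,1)\to[0,\infty)$ with $\int_0^1\sigma(u)\,du=1$; $\mathscr{S}$ is nonempty. For a random variable $Y$ and $0<u<1$ let $F_Y^{-1}(u):=\inf\{y:P(Y\le y)\ge u\}$, and let $\rho_\sigma(Y):=\int_0^1\sigma(u)F_Y^{-1}(u)\,du$ when the integral exists. Put $\rho_{\mathscr{S}}(Y):=\sup_{\sigma\in\mathscr{S}}\rho_\sigma(Y)$, $\|Y\|_{\mathscr{S}}:=\rho_{\mathscr{S}}(|Y|)=\sup_{\sigma\in\mathscr{S}}\rho_\sigma(|Y|)\in[0,\infty]$, and $L_{\mathscr{S}}:=\{Y\in L^1:\|Y\|_{\mathscr{S}}<\infty\}$. *)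

theory Defs
  imports "HOL-Probability.Probability"
begin

text \<open>Values of \<open>\<sigma>\<close> outside \<open>[0,1)\<close> are irrelevant. A function that is monotone on \<open>[0,1)\<close>
  is measurable there, so no separate measurability requirement is needed.\<close>

definition spectral_function :: "(real \<Rightarrow> real) \<Rightarrow> bool" where
  "spectral_function \<sigma> \<longleftrightarrow>
     mono_on {0..<1} \<sigma> \<and> (\<forall>u\<in>{0..<1}. 0 \<le> \<sigma> u) \<and>
     (\<integral>\<^sup>+u\<in>{0..<1}. ennreal (\<sigma> u) \<partial>lborel) = 1"

text \<open>Only used for \<open>0 < u < 1\<close>, where the set is nonempty and bounded below.\<close>

definition quantile :: "'a measure \<Rightarrow> ('a \<Rightarrow> real) \<Rightarrow> real \<Rightarrow> real" where
  "quantile M Y u = Inf {y. u \<le> \<P>(\<omega> in M. Y \<omega> \<le> y)}"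

text \<open>The integral of \<open>\<sigma> u * quantile M Y u\<close> over \<open>(0,1)\<close> is taken in the extended sense: it
  exists if the integrals of the positive and of the negative part are not both infinite, and
  it may then be infinite.\<close>

definition spectral_pos :: "'a measure \<Rightarrow> (real \<Rightarrow> real) \<Rightarrow> ('a \<Rightarrow> real) \<Rightarrow> ennreal" where
  "spectral_pos M \<sigma> Y = (\<integral>\<^sup>+u\<in>{0<..<1}. ennreal (\<sigma> u * quantile M Y u) \<partial>lborel)"

definition spectral_neg :: "'a measure \<Rightarrow> (real \<Rightarrow> real) \<Rightarrow> ('a \<Rightarrow> real) \<Rightarrow> ennreal" where
  "spectral_neg M \<sigma> Y = (\<integral>\<^sup>+u\<in>{0<..<1}. ennreal (- (\<sigma> u * quantile M Y u)) \<partial>lborel)"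

definition spectral_risk_exists ::
    "'a measure \<Rightarrow> (real \<Rightarrow> real) \<Rightarrow> ('a \<Rightarrow> real) \<Rightarrow> bool" where
  "spectral_risk_exists M \<sigma> Y \<longleftrightarrow> spectral_pos M \<sigma> Y < \<infinity> \<or> spectral_neg M \<sigma> Y < \<infinity>"

definition spectral_risk :: "'a measure \<Rightarrow> (real \<Rightarrow> real) \<Rightarrow> ('a \<Rightarrow> real) \<Rightarrow> ereal" where
  "spectral_risk M \<sigma> Y = enn2ereal (spectral_pos M \<sigma> Y) - enn2ereal (spectral_neg M \<sigma> Y)"

definition sup_risk :: "'a measure \<Rightarrow> (real \<Rightarrow> real) set \<Rightarrow> ('a \<Rightarrow> real) \<Rightarrow> ereal" where
  "sup_risk M S Y = (SUP \<sigma>\<in>S. spectral_risk M \<sigma> Y)"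

definition spectral_norm :: "'a measure \<Rightarrow> (real \<Rightarrow> real) set \<Rightarrow> ('a \<Rightarrow> real) \<Rightarrow> ereal" where
  "spectral_norm M S Y = sup_risk M S (\<lambda>\<omega>. \<bar>Y \<omega>\<bar>)"

text \<open>Elements are representatives of almost-sure equivalence classes; the lemmas below show
  that the notions depend only on the class.\<close>

definition spectral_space :: "'a measure \<Rightarrow> (real \<Rightarrow> real) set \<Rightarrow> ('a \<Rightarrow> real) set" where
  "spectral_space M S = {Y. integrable M Y \<and> spectral_norm M S Y < \<infinity>}"

lemma quantile_cong_AE:
  assumes [measurable]: "X \<in> borel_measurable M" "Y \<in> borel_measurable M"
    and eq: "AE \<omega> in M. X \<omega> = Y \<omega>"
  shows "quantile M X = quantile M Y"
proof -
  have "\<P>(\<omega> in M. X \<omega> \<le> y) = \<P>(\<omega> in M. Y \<omega> \<le> y)" for y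
    by (rule measure_eq_AE) (use eq in auto)
  then show ?thesis
    by (simp add: quantile_def fun_eq_iff)
qed

lemma sup_risk_cong_AE:
  assumes "X \<in> borel_measurable M" "Y \<in> borel_measurable M" "AE \<omega> in M. X \<omega> = Y \<omega>"
  shows "sup_risk M S X = sup_risk M S Y"
  by (simp add: sup_risk_def spectral_risk_def spectral_pos_def spectral_neg_def
      quantile_cong_AE[OF assms])

lemma spectral_norm_cong_AE:
  assumes [measurable]: "X \<in> borel_measurable M" "Y \<in> borel_measurable M"
    and eq: "AE \<omega> in M. X \<omega> = Y \<omega>"
  shows "spectral_norm M S X = spectral_norm M S Y"
  unfolding spectral_norm_def by (rule sup_risk_cong_AE) (use eq in auto)

end

theory Submission imports Defs begin

text \<open>
  All quantile functions of random variables on \<open>M\<close> live on one and the same probability space,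
  the open unit interval with Lebesgue measure, and there \<open>quantile M Y\<close> has the same
  distribution as \<open>Y\<close>. So \<open>\<rho>\<^sub>\<sigma>(Y)\<close> is an ordinary expectation of \<open>\<sigma> \<cdot> quantile M Y\<close> on the unit
  interval as soon as this product is integrable.

  Integrability for \<open>Y\<close> in the space is the lemma \<open>integrable_spectral_quantile\<close>. The positive
  part is dominated by the integrand of \<open>\<rho>\<^sub>\<sigma>(\<bar>Y\<bar>)\<close>. The negative part can only be large near
  \<open>0\<close>, where \<open>\<sigma>\<close> is bounded and the quantile function of the integrable \<open>Y\<close> is integrable.
  Monotonicity of quantiles then gives \<open>-\<infinity> < \<rho>\<^sub>\<sigma>(Y) \<le> \<rho>\<^sub>\<sigma>(\<bar>Y\<bar>)\<close>, so the supremum is finite.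

  The Lipschitz bound comes from subadditivity and monotonicity,
  \<open>\<rho>\<^sub>\<sigma>(Y) \<le> \<rho>\<^sub>\<sigma>(X) + \<rho>\<^sub>\<sigma>(Y - X) \<le> \<rho>\<^sub>\<sigma>(X) + \<rho>\<^sub>\<sigma>(\<bar>Y - X\<bar>)\<close>, by taking suprema over \<open>\<sigma>\<close> and
  exchanging \<open>X\<close> and \<open>Y\<close>. Subadditivity is proved first for the simplest spectral functions, multiples
  of the indicator of an upper interval \<open>A\<close> with left endpoint \<open>a\<close>. There it follows from the
  variational formula
  \<open>\<integral>\<^sub>A quantile Y = min\<^sub>c (c \<bar>A\<bar> + E (Y - c)\<^sup>+)\<close>, whose minimum is attained at \<open>c = quantile Y a\<close> if \<open>0 < a < 1\<close>
  (lemmas \<open>upper_quantile_integral_le\<close> and \<open>upper_quantile_integral_eq\<close>), because the positive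
  part is subadditive. A general \<open>\<sigma>\<close> is nondecreasing, so every set \<open>{\<sigma> > t}\<close> is such an upper
  interval, and \<open>\<sigma>\<close> is the integral over \<open>t > 0\<close> of their indicators; Fubini's theorem
  (lemma \<open>layer_cake_nonpos\<close>) transfers the inequality.
\<close>

section \<open>Layer-cake argument\<close>

text \<open>
  Since \<open>w x\<close> is the length of \<open>{0<..<w x}\<close>, the integral of \<open>w \<cdot> h\<close> is a double integral that,
  in the other order, averages the integrals of \<open>h\<close> over the level sets of \<open>w\<close>.
\<close>

lemma layer_cake_nonpos:
  fixes w h :: "'b \<Rightarrow> real"
  assumes "sigma_finite_measure N"
    and w[measurable]: "w \<in> borel_measurable N" and h[measurable]: "h \<in> borel_measurable N"
    and w_nonneg: "\<And>x. x \<in> space N \<Longrightarrow> 0 \<le> w x"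
    and int: "integrable N (\<lambda>x. w x * h x)"
    and level: "\<And>t. 0 < t \<Longrightarrow> (\<integral>x. indicator {x \<in> space N. t < w x} x * h x \<partial>N) \<le> 0"
  shows "(\<integral>x. w x * h x \<partial>N) \<le> 0"
proof -
  interpret N: sigma_finite_measure N by fact
  interpret P: pair_sigma_finite N lborel by standard
  define f :: "'b \<Rightarrow> real \<Rightarrow> real" where "f x t = indicator {0<..<w x} t * h x" for x t
  have f_alt: "f x t = (if 0 < t \<and> t < w x then h x else 0)" for x t
    by (auto simp: f_def indicator_def)
  have [measurable]: "case_prod f \<in> borel_measurable (N \<Otimes>\<^sub>M lborel)"
    unfolding f_alt by measurable
  have len: "measure lborel {0<..<w x} = w x" if "x \<in> space N" for x
    using w_nonneg[OF that] by simp
  have inner_int: "integrable lborel (f x)" for x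
    unfolding f_def by (cases "0 \<le> w x") (auto intro!: integrable_mult_left)
  have inner: "(\<integral>t. f x t \<partial>lborel) = w x * h x" if "x \<in> space N" for x
    unfolding f_def using len[OF that] by simp
  have inner_norm: "(\<integral>t. norm (f x t) \<partial>lborel) = \<bar>w x * h x\<bar>" if "x \<in> space N" for x
    unfolding f_def using len[OF that] w_nonneg[OF that] by (simp add: abs_mult)
  have f_int: "integrable (N \<Otimes>\<^sub>M lborel) (case_prod f)"
  proof (rule P.Fubini_integrable)
    have "integrable N (\<lambda>x. \<bar>w x * h x\<bar>)"
      using int by (rule integrable_abs)
    then show "integrable N (\<lambda>x. \<integral>t. norm (case_prod f (x, t)) \<partial>lborel)"
      by (rule Bochner_Integration.integrable_cong[THEN iffD2, rotated 2]) (simp_all add: inner_norm[simplified])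
  qed (use inner_int in simp_all)
  have "(\<integral>x. w x * h x \<partial>N) = (\<integral>x. (\<integral>t. f x t \<partial>lborel) \<partial>N)"
    by (rule Bochner_Integration.integral_cong) (simp_all add: inner)
  also have "\<dots> = (\<integral>t. (\<integral>x. f x t \<partial>N) \<partial>lborel)"
    using P.integral_fst[OF f_int] P.integral_snd[OF f_int] by simp
  also have "\<dots> \<le> (\<integral>t. 0 \<partial>(lborel :: real measure))"
  proof (rule integral_mono)
    show "integrable lborel (\<lambda>t. \<integral>x. f x t \<partial>N)"
      using f_int by (rule P.integrable_snd)
    fix t :: real
    show "(\<integral>x. f x t \<partial>N) \<le> 0"
    proof (cases "0 < t")
      case True
      then have "(\<integral>x. f x t \<partial>N) = (\<integral>x. indicator {x \<in> space N. t < w x} x * h x \<partial>N)"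
        by (intro Bochner_Integration.integral_cong) (auto simp: f_alt)
      then show ?thesis using level[OF True] by simp
    qed (simp add: f_alt)
  qed simp
  finally show ?thesis by simp
qed

section \<open>Quantile functions on the unit interval\<close>

abbreviation unit_lborel :: "real measure" where
  "unit_lborel \<equiv> restrict_space lborel {0<..<1}"

lemma prob_space_unit_lborel: "prob_space unit_lborel"
  by (auto intro!: prob_spaceI simp: emeasure_restrict_space space_restrict_space)

lemma space_unit_lborel [simp]: "space unit_lborel = {0<..<1}"
  by (simp add: space_restrict_space)

lemma mono_on_measurable_unit_lborel:
  "mono_on {0<..<1} f \<Longrightarrow> f \<in> borel_measurable unit_lborel" for f :: "real \<Rightarrow> real"
  using borel_measurable_mono_on_fnc[of "{0<..<1}" f]
  by (simp cong: measurable_cong_sets add: sets_restrict_space)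

context prob_space
begin

text \<open>
  On \<open>(0,1)\<close> the pseudo-inverse of a distribution function forms a Galois connection with it and
  carries Lebesgue measure to the distribution. This equation makes both facts, stated for
  \<^locale>\<open>cdf_distribution\<close>, available for \<^const>\<open>quantile\<close>.
\<close>

lemma quantile_eq_Inf_cdf:
  assumes [measurable]: "random_variable borel Y"
  shows "quantile M Y u = Inf {y. u \<le> cdf (distr M borel Y) y}"
proof -
  have "cdf (distr M borel Y) y = \<P>(\<omega> in M. Y \<omega> \<le> y)" for y
    by (auto simp: cdf_def measure_distr intro!: arg_cong[where f = prob])
  then show ?thesis
    by (simp add: quantile_def)
qed

lemma cdf_distribution_distr:
  "random_variable borel Y \<Longrightarrow> cdf_distribution (distr M borel Y)"
  by (simp add: cdf_distribution_def)

lemma quantile_le_iff: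
  assumes [measurable]: "random_variable borel Y" and u: "0 < u" "u < 1"
  shows "quantile M Y u \<le> y \<longleftrightarrow> u \<le> \<P>(\<omega> in M. Y \<omega> \<le> y)"
proof -
  interpret D: cdf_distribution "distr M borel Y"
    by (rule cdf_distribution_distr) simp
  have "cdf (distr M borel Y) y = \<P>(\<omega> in M. Y \<omega> \<le> y)"
    by (auto simp: cdf_def measure_distr intro!: arg_cong[where f = prob])
  then show ?thesis
    using D.pseudoinverse[OF u, of y] by (simp add: quantile_eq_Inf_cdf)
qed

lemma mono_on_quantile:
  assumes "random_variable borel Y"
  shows "mono_on {0<..<1} (quantile M Y)"
proof -
  interpret D: cdf_distribution "distr M borel Y"
    by (rule cdf_distribution_distr) fact
  show ?thesis
    using D.mono_I by (simp add: ext[OF quantile_eq_Inf_cdf[OF assms]])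
qed

lemma quantile_measurable [measurable]:
  "random_variable borel Y \<Longrightarrow> quantile M Y \<in> borel_measurable unit_lborel"
  by (intro mono_on_measurable_unit_lborel mono_on_quantile)

lemma distr_quantile:
  assumes "random_variable borel Y"
  shows "distr unit_lborel borel (quantile M Y) = distr M borel Y"
proof -
  interpret D: cdf_distribution "distr M borel Y"
    by (rule cdf_distribution_distr) fact
  show ?thesis
    using D.distr_I_eq_M by (simp add: ext[OF quantile_eq_Inf_cdf[OF assms]])
qed

lemma integrable_quantile_iff:
  fixes f :: "real \<Rightarrow> real"
  assumes [measurable]: "random_variable borel Y" "f \<in> borel_measurable borel"
  shows "integrable unit_lborel (\<lambda>u. f (quantile M Y u)) \<longleftrightarrow> integrable M (\<lambda>\<omega>. f (Y \<omega>))"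
  using integrable_distr_eq[of "quantile M Y" unit_lborel borel f]
    integrable_distr_eq[of Y M borel f]
  unfolding distr_quantile[OF assms(1)] by (metis assms quantile_measurable)

lemma integral_quantile:
  fixes f :: "real \<Rightarrow> real"
  assumes [measurable]: "random_variable borel Y" "f \<in> borel_measurable borel"
  shows "(\<integral>u. f (quantile M Y u) \<partial>unit_lborel) = expectation (\<lambda>\<omega>. f (Y \<omega>))"
  using integral_distr[of "quantile M Y" unit_lborel borel f] integral_distr[of Y M borel f]
  unfolding distr_quantile[OF assms(1)] by (metis assms quantile_measurable)

lemma quantile_mono:
  assumes [measurable]: "random_variable borel X" "random_variable borel Y"
    and le: "\<And>\<omega>. \<omega> \<in> space M \<Longrightarrow> X \<omega> \<le> Y \<omega>" and u: "0 < u" "u < 1"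
  shows "quantile M X u \<le> quantile M Y u"
proof -
  have "u \<le> \<P>(\<omega> in M. Y \<omega> \<le> quantile M Y u)"
    using quantile_le_iff[of Y u "quantile M Y u"] u by simp
  also have "\<dots> \<le> \<P>(\<omega> in M. X \<omega> \<le> quantile M Y u)"
    by (intro finite_measure_mono) (auto intro: le order_trans)
  finally show ?thesis
    using quantile_le_iff[of X u "quantile M Y u"] u by simp
qed

lemma quantile_nonneg:
  assumes [measurable]: "random_variable borel Y"
    and nonneg: "\<And>\<omega>. \<omega> \<in> space M \<Longrightarrow> 0 \<le> Y \<omega>" and u: "0 < u" "u < 1"
  shows "0 \<le> quantile M Y u"
proof (rule ccontr)
  assume "\<not> 0 \<le> quantile M Y u"
  then have "{\<omega> \<in> space M. Y \<omega> \<le> quantile M Y u} = {}"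
    using nonneg by fastforce
  then have "\<P>(\<omega> in M. Y \<omega> \<le> quantile M Y u) = 0"
    by (metis measure_empty)
  then show False
    using quantile_le_iff[of Y u "quantile M Y u"] u by simp
qed

section \<open>Integrals of quantile functions over upper intervals\<close>

lemma integrable_upper_quantile:
  assumes Y: "integrable M Y" and A: "A \<in> sets unit_lborel"
  shows "integrable unit_lborel (\<lambda>u. indicator A u * quantile M Y u)"
proof -
  have "integrable unit_lborel (quantile M Y)"
    using integrable_quantile_iff[OF borel_measurable_integrable[OF Y], of "\<lambda>x. x"] Y by simp
  from integrable_mult_indicator[OF A this] show ?thesis by simp
qed

lemma integrable_positive_part_quantile:
  assumes Y: "integrable M Y"
  shows "integrable unit_lborel (\<lambda>u. max 0 (quantile M Y u - c))"
  by (subst integrable_quantile_iff[OF borel_measurable_integrable[OF Y]]) (use Y in auto)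

text \<open>Pointwise, \<open>q \<le> c + (q - c)\<^sup>+\<close> on \<open>A\<close> and \<open>0 \<le> (q - c)\<^sup>+\<close> off \<open>A\<close>.\<close>

lemma upper_quantile_integral_le:
  assumes Y: "integrable M Y" and A: "A \<in> sets unit_lborel"
  shows "(\<integral>u. indicator A u * quantile M Y u \<partial>unit_lborel)
    \<le> c * measure unit_lborel A + expectation (\<lambda>\<omega>. max 0 (Y \<omega> - c))"
proof -
  interpret U: prob_space unit_lborel by (rule prob_space_unit_lborel)
  have [measurable]: "random_variable borel Y" using Y by simp
  note int = integrable_positive_part_quantile[OF Y, of c]
  have intA: "integrable unit_lborel (\<lambda>u. c * indicator A u)"
    using A by (intro integrable_mult_right integrable_real_indicator) (auto simp: U.emeasure_eq_measure)
  have "(\<integral>u. indicator A u * quantile M Y u \<partial>unit_lborel)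
      \<le> (\<integral>u. c * indicator A u + max 0 (quantile M Y u - c) \<partial>unit_lborel)"
    by (intro integral_mono integrable_upper_quantile Y A Bochner_Integration.integrable_add int intA)
      (auto simp: indicator_def)
  also have "\<dots> = c * measure unit_lborel A + (\<integral>u. max 0 (quantile M Y u - c) \<partial>unit_lborel)"
    using A sets.sets_into_space[OF A]
    by (subst Bochner_Integration.integral_add[OF intA int]) (simp add: Int_absorb2)
  also have "(\<integral>u. max 0 (quantile M Y u - c) \<partial>unit_lborel) = expectation (\<lambda>\<omega>. max 0 (Y \<omega> - c))"
    by (rule integral_quantile) simp_all
  finally show ?thesis .
qed

text \<open>The pointwise inequalities above are equalities if \<open>A\<close> separates the values of the
  quantile function at \<open>c\<close>.\<close>

lemma upper_quantile_integral_eq: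
  assumes Y: "integrable M Y" and A: "A \<in> sets unit_lborel"
    and above: "\<And>u. u \<in> A \<Longrightarrow> c \<le> quantile M Y u"
    and below: "\<And>u. u \<in> {0<..<1} - A \<Longrightarrow> quantile M Y u \<le> c"
  shows "(\<integral>u. indicator A u * quantile M Y u \<partial>unit_lborel)
    = c * measure unit_lborel A + expectation (\<lambda>\<omega>. max 0 (Y \<omega> - c))"
proof -
  interpret U: prob_space unit_lborel by (rule prob_space_unit_lborel)
  have [measurable]: "random_variable borel Y" using Y by simp
  note int = integrable_positive_part_quantile[OF Y, of c]
  have intA: "integrable unit_lborel (\<lambda>u. c * indicator A u)"
    using A by (intro integrable_mult_right integrable_real_indicator) (auto simp: U.emeasure_eq_measure)
  have "indicator A u * quantile M Y u = c * indicator A u + max 0 (quantile M Y u - c)"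
    if "u \<in> {0<..<1}" for u
    using above[of u] below[of u] that by (cases "u \<in> A") simp_all
  then have "(\<integral>u. indicator A u * quantile M Y u \<partial>unit_lborel)
      = (\<integral>u. c * indicator A u + max 0 (quantile M Y u - c) \<partial>unit_lborel)"
    by (intro Bochner_Integration.integral_cong) simp_all
  also have "\<dots> = c * measure unit_lborel A + (\<integral>u. max 0 (quantile M Y u - c) \<partial>unit_lborel)"
    using A sets.sets_into_space[OF A]
    by (subst Bochner_Integration.integral_add[OF intA int]) (simp add: Int_absorb2)
  also have "(\<integral>u. max 0 (quantile M Y u - c) \<partial>unit_lborel) = expectation (\<lambda>\<omega>. max 0 (Y \<omega> - c))"
    by (rule integral_quantile) simp_all
  finally show ?thesis .
qed

text \<open>
  The optimal levels of \<open>X\<close> and \<open>Y\<close> add up to an admissible level for \<open>X + Y\<close>. Only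
  the full interval, whose left endpoint \<open>0\<close> has no quantile, has to be treated
  separately; there the integrals are expectations.
\<close>

lemma upper_quantile_integral_subadditive:
  assumes X: "integrable M X" and Y: "integrable M Y" and A: "A \<in> sets unit_lborel"
    and upper: "\<And>u v. u \<in> A \<Longrightarrow> u \<le> v \<Longrightarrow> v < 1 \<Longrightarrow> v \<in> A"
  shows "(\<integral>u. indicator A u * quantile M (\<lambda>\<omega>. X \<omega> + Y \<omega>) u \<partial>unit_lborel)
    \<le> (\<integral>u. indicator A u * quantile M X u \<partial>unit_lborel)
      + (\<integral>u. indicator A u * quantile M Y u \<partial>unit_lborel)"
proof -
  have XY: "integrable M (\<lambda>\<omega>. X \<omega> + Y \<omega>)" using X Y by simp
  have sub: "A \<subseteq> {0<..<1}" using sets.sets_into_space[OF A] by simp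
  consider "A = {}" | "A = {0<..<1}" | w where "w \<in> {0<..<1}" "w \<notin> A" "A \<noteq> {}"
    using sub by blast
  then show ?thesis
  proof cases
    case 2
    have full: "(\<integral>u. indicator A u * quantile M Z u \<partial>unit_lborel) = expectation Z"
      if "integrable M Z" for Z
    proof -
      have "(\<integral>u. indicator A u * quantile M Z u \<partial>unit_lborel) = (\<integral>u. quantile M Z u \<partial>unit_lborel)"
        by (intro Bochner_Integration.integral_cong) (auto simp: 2)
      then show ?thesis
        using integral_quantile[OF borel_measurable_integrable[OF that], of "\<lambda>x. x"] by simp
    qed
    show ?thesis
      using X Y XY by (simp add: full)
  next
    case 3
    define a where "a = Inf A"
    have bdd: "bdd_below A" using sub by (intro bdd_belowI[of _ 0]) auto
    have "w \<le> u" if "u \<in> A" for u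
      using upper[OF that, of w] 3 by force
    then have "w \<le> a" unfolding a_def using 3 by (intro cInf_greatest) auto
    then have a0: "0 < a" using 3 by simp
    have aA: "a \<le> u" if "u \<in> A" for u
      unfolding a_def using that bdd by (rule cInf_lower)
    have a1: "a < 1" using 3 aA sub by fastforce
    have notA: "u \<le> a" if u: "u \<in> {0<..<1} - A" for u
    proof (rule ccontr)
      assume "\<not> u \<le> a"
      then obtain v where "v \<in> A" "v < u"
        using 3 bdd by (auto simp: a_def cInf_less_iff not_le)
      then show False using upper[of v u] u by auto
    qed
    have eq: "(\<integral>u. indicator A u * quantile M Z u \<partial>unit_lborel)
        = quantile M Z a * measure unit_lborel A + expectation (\<lambda>\<omega>. max 0 (Z \<omega> - quantile M Z a))"
      if Z: "integrable M Z" for Z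
    proof (rule upper_quantile_integral_eq[OF Z A])
      have mono: "mono_on {0<..<1} (quantile M Z)" using Z by (intro mono_on_quantile) simp
      show "quantile M Z a \<le> quantile M Z u" if "u \<in> A" for u
        using that aA[OF that] a0 a1 sub by (intro mono_onD[OF mono]) auto
      show "quantile M Z u \<le> quantile M Z a" if "u \<in> {0<..<1} - A" for u
        using that notA[OF that] a0 a1 by (intro mono_onD[OF mono]) auto
    qed
    let ?x = "quantile M X a" and ?y = "quantile M Y a"
    have "expectation (\<lambda>\<omega>. max 0 (X \<omega> + Y \<omega> - (?x + ?y)))
        \<le> expectation (\<lambda>\<omega>. max 0 (X \<omega> - ?x) + max 0 (Y \<omega> - ?y))"
      using X Y by (intro integral_mono) auto
    also have "\<dots> = expectation (\<lambda>\<omega>. max 0 (X \<omega> - ?x)) + expectation (\<lambda>\<omega>. max 0 (Y \<omega> - ?y))"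
      using X Y by (intro Bochner_Integration.integral_add) auto
    finally show ?thesis
      using upper_quantile_integral_le[OF XY A, of "?x + ?y"] eq[OF X] eq[OF Y]
      by (simp add: algebra_simps)
  qed simp
qed

section \<open>Spectral risk measures\<close>

text \<open>
  The layer-cake argument is applied to the difference of the two sides, since \<open>\<sigma>\<close> being
  nondecreasing makes each level set \<open>{\<sigma> > t}\<close> an upper interval.
\<close>

lemma spectral_integral_subadditive:
  assumes mono: "mono_on {0<..<1} \<sigma>" and nonneg: "\<And>u. u \<in> {0<..<1} \<Longrightarrow> 0 \<le> \<sigma> u"
    and X: "integrable M X" and Y: "integrable M Y"
    and iX: "integrable unit_lborel (\<lambda>u. \<sigma> u * quantile M X u)"
    and iY: "integrable unit_lborel (\<lambda>u. \<sigma> u * quantile M Y u)"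
    and iXY: "integrable unit_lborel (\<lambda>u. \<sigma> u * quantile M (\<lambda>\<omega>. X \<omega> + Y \<omega>) u)"
  shows "(\<integral>u. \<sigma> u * quantile M (\<lambda>\<omega>. X \<omega> + Y \<omega>) u \<partial>unit_lborel)
    \<le> (\<integral>u. \<sigma> u * quantile M X u \<partial>unit_lborel) + (\<integral>u. \<sigma> u * quantile M Y u \<partial>unit_lborel)"
proof -
  interpret U: prob_space unit_lborel by (rule prob_space_unit_lborel)
  have XY: "integrable M (\<lambda>\<omega>. X \<omega> + Y \<omega>)" using X Y by simp
  have [measurable]: "random_variable borel X" "random_variable borel Y"
    using X Y by simp_all
  have \<sigma>[measurable]: "\<sigma> \<in> borel_measurable unit_lborel"
    using mono by (rule mono_on_measurable_unit_lborel)
  define h where "h u = quantile M (\<lambda>\<omega>. X \<omega> + Y \<omega>) u - (quantile M X u + quantile M Y u)" for u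
  have h_int: "(\<integral>u. g u * h u \<partial>unit_lborel)
      = (\<integral>u. g u * quantile M (\<lambda>\<omega>. X \<omega> + Y \<omega>) u \<partial>unit_lborel)
        - ((\<integral>u. g u * quantile M X u \<partial>unit_lborel) + (\<integral>u. g u * quantile M Y u \<partial>unit_lborel))"
    if "integrable unit_lborel (\<lambda>u. g u * quantile M X u)"
      "integrable unit_lborel (\<lambda>u. g u * quantile M Y u)"
      "integrable unit_lborel (\<lambda>u. g u * quantile M (\<lambda>\<omega>. X \<omega> + Y \<omega>) u)" for g
    using that by (simp add: h_def right_diff_distrib distrib_left)
  have "(\<integral>u. \<sigma> u * h u \<partial>unit_lborel) \<le> 0"
  proof (rule layer_cake_nonpos)
    show "sigma_finite_measure unit_lborel" by unfold_locales
    show "h \<in> borel_measurable unit_lborel"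
      unfolding h_def by measurable
    show "integrable unit_lborel (\<lambda>u. \<sigma> u * h u)"
      using iX iY iXY by (simp add: h_def right_diff_distrib distrib_left)
    fix t :: real assume "0 < t"
    let ?A = "{u \<in> space unit_lborel. t < \<sigma> u}"
    have A: "?A \<in> sets unit_lborel" by measurable
    have upper: "v \<in> ?A" if "u \<in> ?A" "u \<le> v" "v < 1" for u v
      using that mono_onD[OF mono, of u v] by auto
    show "(\<integral>u. indicator ?A u * h u \<partial>unit_lborel) \<le> 0"
      unfolding h_int[OF integrable_upper_quantile[OF X A] integrable_upper_quantile[OF Y A]
          integrable_upper_quantile[OF XY A]] diff_le_0_iff_le
      by (rule upper_quantile_integral_subadditive[OF X Y A upper])
  qed (use nonneg in auto)
  then show ?thesis
    using h_int[OF iX iY iXY] by simp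
qed

lemma spectral_pos_unit_lborel:
  "spectral_pos M \<sigma> Y = (\<integral>\<^sup>+u. ennreal (\<sigma> u * quantile M Y u) \<partial>unit_lborel)"
  by (simp add: spectral_pos_def nn_integral_restrict_space)

lemma spectral_neg_unit_lborel:
  "spectral_neg M \<sigma> Y = (\<integral>\<^sup>+u. ennreal (- (\<sigma> u * quantile M Y u)) \<partial>unit_lborel)"
  by (simp add: spectral_neg_def nn_integral_restrict_space)

lemma spectral_risk_eq_integral:
  assumes "integrable unit_lborel (\<lambda>u. \<sigma> u * quantile M Y u)"
  shows "spectral_risk M \<sigma> Y = ereal (\<integral>u. \<sigma> u * quantile M Y u \<partial>unit_lborel)"
proof -
  obtain r q where "0 \<le> r" "0 \<le> q"
    "(\<integral>\<^sup>+u. ennreal (\<sigma> u * quantile M Y u) \<partial>unit_lborel) = ennreal r"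
    "(\<integral>\<^sup>+u. ennreal (- (\<sigma> u * quantile M Y u)) \<partial>unit_lborel) = ennreal q"
    "(\<integral>u. \<sigma> u * quantile M Y u \<partial>unit_lborel) = r - q"
    by (rule integrableE[OF assms])
  then show ?thesis
    by (simp add: spectral_risk_def spectral_pos_unit_lborel spectral_neg_unit_lborel enn2ereal_ennreal)
qed

lemma spectral_risk_exists_if_integrable:
  assumes "integrable unit_lborel (\<lambda>u. \<sigma> u * quantile M Y u)"
  shows "spectral_risk_exists M \<sigma> Y"
  using assms unfolding real_integrable_def
  by (simp add: spectral_risk_exists_def spectral_pos_unit_lborel less_top)

lemma spectral_function_unit_lborel:
  assumes "spectral_function \<sigma>"
  shows "mono_on {0<..<1} \<sigma>" "\<And>u. u \<in> {0<..<1} \<Longrightarrow> 0 \<le> \<sigma> u" "integrable unit_lborel \<sigma>"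
proof -
  show mono: "mono_on {0<..<1} \<sigma>"
    using assms by (auto simp: spectral_function_def intro: mono_on_subset)
  show nonneg: "0 \<le> \<sigma> u" if "u \<in> {0<..<1}" for u
    using assms that by (auto simp: spectral_function_def)
  have "(\<integral>\<^sup>+u. ennreal (\<sigma> u) \<partial>unit_lborel) = (\<integral>\<^sup>+u\<in>{0<..<1}. ennreal (\<sigma> u) \<partial>lborel)"
    by (simp add: nn_integral_restrict_space)
  also have "\<dots> \<le> (\<integral>\<^sup>+u\<in>{0..<1}. ennreal (\<sigma> u) \<partial>lborel)"
    by (intro nn_integral_mono) (auto simp: indicator_def)
  also have "\<dots> = 1"
    using assms by (simp add: spectral_function_def)
  finally have fin: "(\<integral>\<^sup>+u. ennreal (\<sigma> u) \<partial>unit_lborel) < \<infinity>"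
    using le_less_trans by force
  show "integrable unit_lborel \<sigma>"
    by (rule integrableI_nonneg[OF mono_on_measurable_unit_lborel[OF mono] _ fin])
      (use nonneg in \<open>auto intro!: AE_I2\<close>)
qed

text \<open>For a nonnegative variable the negative part vanishes, so the risk controls
  the whole integral.\<close>

lemma integrable_spectral_quantile_nonneg:
  assumes \<sigma>: "spectral_function \<sigma>" and [measurable]: "random_variable borel Z"
    and Z: "\<And>\<omega>. \<omega> \<in> space M \<Longrightarrow> 0 \<le> Z \<omega>" and fin: "spectral_risk M \<sigma> Z < \<infinity>"
  shows "integrable unit_lborel (\<lambda>u. \<sigma> u * quantile M Z u)"
proof -
  note s = spectral_function_unit_lborel[OF \<sigma>]
  have nonneg: "0 \<le> \<sigma> u * quantile M Z u" if "u \<in> {0<..<1}" for u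
    using that s(2)[OF that] quantile_nonneg[of Z u] Z by auto
  have "spectral_neg M \<sigma> Z = (\<integral>\<^sup>+u. 0 \<partial>unit_lborel)"
    unfolding spectral_neg_unit_lborel using nonneg
    by (intro nn_integral_cong) (simp add: ennreal_neg)
  then have "spectral_pos M \<sigma> Z < \<infinity>"
    using fin by (cases "spectral_pos M \<sigma> Z") (auto simp: spectral_risk_def zero_ennreal.rep_eq)
  then show ?thesis
    using nonneg s(3) by (intro integrableI_nonneg) (auto simp: spectral_pos_unit_lborel intro!: AE_I2)
qed

text \<open>
  Where \<open>q = quantile M Y\<close> is negative, \<open>\<sigma> \<bar>q\<bar>\<close> is at most \<open>\<sigma>(1/2) \<bar>q\<bar>\<close> to the left of \<open>1/2\<close>,
  since \<open>\<sigma>\<close> is nondecreasing, and at most \<open>\<sigma> \<bar>q(1/2)\<bar>\<close> to the right, since \<open>q\<close> is nondecreasing.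
\<close>

lemma integrable_spectral_quantile:
  assumes \<sigma>: "spectral_function \<sigma>" and Y: "integrable M Y"
    and fin: "spectral_risk M \<sigma> (\<lambda>\<omega>. \<bar>Y \<omega>\<bar>) < \<infinity>"
  shows "integrable unit_lborel (\<lambda>u. \<sigma> u * quantile M Y u)"
proof -
  note s = spectral_function_unit_lborel[OF \<sigma>]
  have [measurable]: "random_variable borel Y" using Y by simp
  note mono_q = mono_on_quantile[of Y]
  let ?b = "\<lambda>u. \<sigma> u * quantile M (\<lambda>\<omega>. \<bar>Y \<omega>\<bar>) u
    + (\<sigma> (1/2) * \<bar>quantile M Y u\<bar> + \<sigma> u * \<bar>quantile M Y (1/2)\<bar>)"
  have "integrable unit_lborel (\<lambda>u. \<bar>quantile M Y u\<bar>)"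
    by (subst integrable_quantile_iff) (use Y in auto)
  then have b: "integrable unit_lborel ?b"
    using fin \<sigma> s(3)
    by (intro Bochner_Integration.integrable_add integrable_spectral_quantile_nonneg) auto
  show ?thesis
  proof (rule Bochner_Integration.integrable_bound[OF b])
    show "(\<lambda>u. \<sigma> u * quantile M Y u) \<in> borel_measurable unit_lborel"
      using s(3) by measurable
    have "\<bar>\<sigma> u * quantile M Y u\<bar> \<le> ?b u" if u: "u \<in> {0<..<1}" for u
    proof -
      have su: "0 \<le> \<sigma> u" "0 \<le> \<sigma> (1/2)" using s(2) u by auto
      have up: "quantile M Y u \<le> quantile M (\<lambda>\<omega>. \<bar>Y \<omega>\<bar>) u"
        using u by (intro quantile_mono) auto
      have abs_nonneg: "0 \<le> quantile M (\<lambda>\<omega>. \<bar>Y \<omega>\<bar>) u"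
        using u by (intro quantile_nonneg) auto
      note terms_nonneg = mult_nonneg_nonneg[OF su(1) abs_nonneg]
        mult_nonneg_nonneg[OF su(2) abs_ge_zero[of "quantile M Y u"]]
        mult_nonneg_nonneg[OF su(1) abs_ge_zero[of "quantile M Y (1/2)"]]
      consider "0 \<le> quantile M Y u" | "quantile M Y u < 0" "u \<le> 1/2" | "quantile M Y u < 0" "1/2 \<le> u"
        by linarith
      then show ?thesis
      proof cases
        case 1
        then have "\<bar>\<sigma> u * quantile M Y u\<bar> \<le> \<sigma> u * quantile M (\<lambda>\<omega>. \<bar>Y \<omega>\<bar>) u"
          using up su by (simp add: mult_left_mono)
        then show ?thesis using terms_nonneg by linarith
      next
        case 2
        then have "\<sigma> u \<le> \<sigma> (1/2)"
          using u by (intro mono_onD[OF s(1)]) auto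
        then have "\<bar>\<sigma> u * quantile M Y u\<bar> \<le> \<sigma> (1/2) * \<bar>quantile M Y u\<bar>"
          using su by (simp add: abs_mult mult_right_mono)
        then show ?thesis using terms_nonneg by linarith
      next
        case 3
        then have "quantile M Y (1/2) \<le> quantile M Y u"
          using u by (intro mono_onD[OF mono_q]) auto
        then have "\<bar>\<sigma> u * quantile M Y u\<bar> \<le> \<sigma> u * \<bar>quantile M Y (1/2)\<bar>"
          using su 3 by (simp add: abs_mult mult_left_mono)
        then show ?thesis using terms_nonneg by linarith
      qed
    qed
    then show "AE u in unit_lborel. norm (\<sigma> u * quantile M Y u) \<le> norm (?b u)"
      by (intro AE_I2) fastforce
  qed
qed

lemma spectral_risk_mono:
  assumes \<sigma>: "spectral_function \<sigma>"
    and X: "random_variable borel X" and Y: "random_variable borel Y"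
    and le: "\<And>\<omega>. \<omega> \<in> space M \<Longrightarrow> X \<omega> \<le> Y \<omega>"
  shows "spectral_risk M \<sigma> X \<le> spectral_risk M \<sigma> Y"
proof -
  have le': "\<sigma> u * quantile M X u \<le> \<sigma> u * quantile M Y u" if "u \<in> {0<..<1}" for u
    using spectral_function_unit_lborel(2)[OF \<sigma> that] quantile_mono[OF X Y le, of u] that
    by (auto intro: mult_left_mono)
  have "spectral_pos M \<sigma> X \<le> spectral_pos M \<sigma> Y"
    unfolding spectral_pos_unit_lborel using le'
    by (intro nn_integral_mono ennreal_leI) simp
  moreover have "spectral_neg M \<sigma> Y \<le> spectral_neg M \<sigma> X"
    unfolding spectral_neg_unit_lborel using le'
    by (intro nn_integral_mono ennreal_leI) simp
  ultimately show ?thesis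
    unfolding spectral_risk_def
    by (intro ereal_minus_mono) (simp_all add: less_eq_ennreal.rep_eq[symmetric])
qed

lemma spectral_risk_le_add_abs_diff:
  assumes \<sigma>: "spectral_function \<sigma>" and X: "integrable M X" and Y: "integrable M Y"
    and fX: "spectral_risk M \<sigma> (\<lambda>\<omega>. \<bar>X \<omega>\<bar>) < \<infinity>" and fY: "spectral_risk M \<sigma> (\<lambda>\<omega>. \<bar>Y \<omega>\<bar>) < \<infinity>"
    and fD: "spectral_risk M \<sigma> (\<lambda>\<omega>. \<bar>Y \<omega> - X \<omega>\<bar>) < \<infinity>"
  shows "spectral_risk M \<sigma> Y \<le> spectral_risk M \<sigma> X + spectral_risk M \<sigma> (\<lambda>\<omega>. \<bar>Y \<omega> - X \<omega>\<bar>)"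
proof -
  note s = spectral_function_unit_lborel[OF \<sigma>]
  have D: "integrable M (\<lambda>\<omega>. Y \<omega> - X \<omega>)" using X Y by simp
  have eq: "(\<lambda>\<omega>. X \<omega> + (Y \<omega> - X \<omega>)) = Y" by simp
  note iX = integrable_spectral_quantile[OF \<sigma> X fX]
    and iY = integrable_spectral_quantile[OF \<sigma> Y fY]
    and iD = integrable_spectral_quantile[OF \<sigma> D fD]
  have "spectral_risk M \<sigma> Y \<le> spectral_risk M \<sigma> X + spectral_risk M \<sigma> (\<lambda>\<omega>. Y \<omega> - X \<omega>)"
    using spectral_integral_subadditive[OF s(1,2) X D iX iD] iY
    by (simp add: eq spectral_risk_eq_integral[OF iX] spectral_risk_eq_integral[OF iY]
        spectral_risk_eq_integral[OF iD])
  also have "\<dots> \<le> spectral_risk M \<sigma> X + spectral_risk M \<sigma> (\<lambda>\<omega>. \<bar>Y \<omega> - X \<omega>\<bar>)"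
    using X Y by (intro add_left_mono spectral_risk_mono \<sigma>) auto
  finally show ?thesis .
qed

section \<open>Finiteness and Lipschitz continuity of the supremum\<close>

lemma spectral_risk_abs_le_spectral_norm:
  "\<sigma> \<in> S \<Longrightarrow> spectral_risk M \<sigma> (\<lambda>\<omega>. \<bar>Y \<omega>\<bar>) \<le> spectral_norm M S Y"
  unfolding spectral_norm_def sup_risk_def by (rule SUP_upper)

lemma integrable_spectral_quantile_space:
  assumes "spectral_function \<sigma>" and \<sigma>: "\<sigma> \<in> S" and Y: "Y \<in> spectral_space M S"
  shows "integrable unit_lborel (\<lambda>u. \<sigma> u * quantile M Y u)"
proof (rule integrable_spectral_quantile)
  have *: "integrable M Y" "spectral_norm M S Y < \<infinity>"
    using Y by (simp_all add: spectral_space_def)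
  show "integrable M Y" by (rule *(1))
  show "spectral_risk M \<sigma> (\<lambda>\<omega>. \<bar>Y \<omega>\<bar>) < \<infinity>"
    using spectral_risk_abs_le_spectral_norm[OF \<sigma>] *(2) by (rule le_less_trans)
qed fact

lemma sup_risk_finite:
  assumes S: "S \<noteq> {}" "\<And>\<sigma>. \<sigma> \<in> S \<Longrightarrow> spectral_function \<sigma>" and Y: "Y \<in> spectral_space M S"
  shows "\<bar>sup_risk M S Y\<bar> \<noteq> \<infinity>"
proof -
  have "integrable M Y" using Y by (simp add: spectral_space_def)
  then have [measurable]: "random_variable borel Y" by simp
  have "sup_risk M S Y \<le> spectral_norm M S Y"
    unfolding sup_risk_def spectral_norm_def
    by (rule SUP_subset_mono[OF order_refl], rule spectral_risk_mono[OF S(2)]) simp_all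
  then have "sup_risk M S Y < \<infinity>"
    using Y by (auto simp: spectral_space_def)
  obtain \<sigma> where \<sigma>: "\<sigma> \<in> S" using S(1) by blast
  have "spectral_risk M \<sigma> Y \<le> sup_risk M S Y"
    unfolding sup_risk_def using \<sigma> by (rule SUP_upper)
  then have "sup_risk M S Y \<noteq> -\<infinity>"
    using spectral_risk_eq_integral[OF integrable_spectral_quantile_space[OF S(2)[OF \<sigma>] \<sigma> Y]] by auto
  with \<open>sup_risk M S Y < \<infinity>\<close> show ?thesis by auto
qed

lemma sup_risk_le_add_spectral_norm:
  assumes S: "\<And>\<sigma>. \<sigma> \<in> S \<Longrightarrow> spectral_function \<sigma>"
    and X: "X \<in> spectral_space M S" and Y: "Y \<in> spectral_space M S"
    and fin: "spectral_norm M S (\<lambda>\<omega>. Y \<omega> - X \<omega>) < \<infinity>"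
  shows "sup_risk M S Y \<le> sup_risk M S X + spectral_norm M S (\<lambda>\<omega>. Y \<omega> - X \<omega>)"
proof -
  have "spectral_risk M \<sigma> Y \<le> sup_risk M S X + spectral_norm M S (\<lambda>\<omega>. Y \<omega> - X \<omega>)"
    if \<sigma>: "\<sigma> \<in> S" for \<sigma>
  proof -
    note le = spectral_risk_abs_le_spectral_norm[OF \<sigma>]
    have "spectral_risk M \<sigma> Y \<le> spectral_risk M \<sigma> X + spectral_risk M \<sigma> (\<lambda>\<omega>. \<bar>Y \<omega> - X \<omega>\<bar>)"
      using X Y fin le[of X] le[of Y] le[of "\<lambda>\<omega>. Y \<omega> - X \<omega>"] S[OF \<sigma>]
      by (intro spectral_risk_le_add_abs_diff) (auto simp: spectral_space_def)
    also have "\<dots> \<le> sup_risk M S X + spectral_norm M S (\<lambda>\<omega>. Y \<omega> - X \<omega>)"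
      using \<sigma> le by (intro add_mono) (auto simp: sup_risk_def intro: SUP_upper)
    finally show ?thesis .
  qed
  then show ?thesis
    unfolding sup_risk_def[of M S Y] by (rule SUP_least)
qed

end

theorem theorem34:
  fixes M :: "'a measure" and S :: "(real \<Rightarrow> real) set"
  assumes "prob_space M"
    and "S \<noteq> {}"
    and "\<And>\<sigma>. \<sigma> \<in> S \<Longrightarrow> spectral_function \<sigma>"
  shows "(\<forall>Y\<in>spectral_space M S.
            (\<forall>\<sigma>\<in>S. spectral_risk_exists M \<sigma> Y) \<and> \<bar>sup_risk M S Y\<bar> \<noteq> \<infinity>) \<and>
         (\<forall>X\<in>spectral_space M S. \<forall>Y\<in>spectral_space M S.
            \<bar>sup_risk M S Y - sup_risk M S X\<bar> \<le> spectral_norm M S (\<lambda>\<omega>. Y \<omega> - X \<omega>))"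
proof (intro conjI ballI)
  interpret prob_space M by fact
  fix Y assume Y: "Y \<in> spectral_space M S"
  show "\<bar>sup_risk M S Y\<bar> \<noteq> \<infinity>"
    using assms(2,3) Y by (rule sup_risk_finite)
  show "spectral_risk_exists M \<sigma> Y" if "\<sigma> \<in> S" for \<sigma>
    using assms(3) that Y
    by (intro spectral_risk_exists_if_integrable integrable_spectral_quantile_space)
next
  interpret prob_space M by fact
  fix X Y assume X: "X \<in> spectral_space M S" and Y: "Y \<in> spectral_space M S"
  let ?n = "spectral_norm M S (\<lambda>\<omega>. Y \<omega> - X \<omega>)"
  have sym: "spectral_norm M S (\<lambda>\<omega>. X \<omega> - Y \<omega>) = ?n"
    by (simp add: spectral_norm_def abs_minus_commute)
  show "\<bar>sup_risk M S Y - sup_risk M S X\<bar> \<le> ?n"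
  proof (cases "?n < \<infinity>")
    case True
    then have "sup_risk M S Y \<le> sup_risk M S X + ?n" "sup_risk M S X \<le> sup_risk M S Y + ?n"
      using sup_risk_le_add_spectral_norm[OF assms(3) X Y]
        sup_risk_le_add_spectral_norm[OF assms(3) Y X] by (simp_all add: sym)
    then show ?thesis
      using sup_risk_finite[OF assms(2,3) X] sup_risk_finite[OF assms(2,3) Y]
      by (cases "sup_risk M S X"; cases "sup_risk M S Y"; cases ?n) auto
  qed simp
qed

end
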